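(* Let $\gamma:S^n\to\mathbb R_{>0}$ be of class $C^2$ and the convex integrand of its Wulff shape $W_\gamma$. Let $X:M=\cup_{i=1}^kM_i\to\mathbb R^{n+1}$ be a closed piecewise-$C^2$ CAMC hypersurface with unit normals $\nu_i:M_i\to S^n$ ($i=1,\dots,k$). Then the collection of the Cahn-Hoffman fields $\tilde\xi_i:=\xi\circ\nu_i:M_i\to\mathbb R^{n+1}$ ($i=1,\dots,k$) defines a $C^0$ map $\tilde\xi:M\to\mathbb R^{n+1}$.
   Context: **Convexity, Cahn-Hoffman map.** $S^n$ is the unit sphere in $\mathbb R^{n+1}$. The Wulff shape $W_\gamma$ is the boundary of $\cap_{\nu\in S^n}\{Y\in\mathbb R^{n+1}\mid\langle Y,\nu\rangle\le\gamma(\nu)\}$. $\gamma$ is a convex integrand if its homogeneous extension $\overline\gamma(rY)=r\gamma(Y)$ ($Y\in S^n$, $r\ge0$) is a convex function on $\mathbb R^{n+1}$. The Cahn-Hoffman map is $\xi(\nu)=D\gamma|_\nu+\gamma(\nu)\nu$, where $D\gamma$ is the gradient on $S^n$ and $T_\nu S^n$ is regarded as a linear subspace of $\mathbb R^{n+1}$. **Piecewise-$C^r$ weak immersion.** $M=\cup_{i=1}^kM_i$ is an $n$-dimensional oriented compact connected $C^\infty$ manifold, where each $M_i$ is an $n$-dimensional connected compact submanifold of $M$ with piecewise-$C^\infty$ boundary and $M_i\cap M_j=\partial M_i\cap\partial M_j$ for $i\neq j$. A map $X:M\to\mathbb R^{n+1}$ is a piecewise-$C^r$ weak immersion if for each $i$: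 (A1) $X$ is continuous and $X|_{M_i}$ is of class $C^r$; (A2) $X$ restricted to the interior $M_i^o$ is a $C^r$-immersion; (A3) the unit normal field $\nu_i:M_i^o\to S^n$ extends to a $C^{r-1}$ map $\nu_i:M_i\to S^n$; here $\nu_i$ is chosen so that, in positively oriented local coordinates $(u^1,\dots,u^n)$, $(\nu_i,\partial_{u^1}X,\dots,\partial_{u^n}X)$ is compatible with the canonical orientation of $\mathbb R^{n+1}$. $S(X)$ is the set of points at which $X$ is not an immersion; $\nu$ is the unit normal on $M\setminus S(X)$. **CAMC.** At regular points, $\Lambda=-\frac1n\operatorname{trace}d(\xi\circ\nu)$, where $d(\xi\circ\nu)$ is regarded as an endomorphism of the tangent space. A piecewise-$C^2$ weak immersion $X$ is CAMC if (i) $\Lambda$ is constant on $M\setminus S(X)$, and (ii) $\tilde\xi_i(\zeta)-\tilde\xi_j(\zeta)\in T_\zeta M_i\cap T_\zeta M_j=T_\zeta(\partial M_i\cap\partial M_j)$ for every $\zeta\in\partial M_i\cap\partial M_j$ (tangent spaces are regarded as linear subspaces of $\mathbb R^{n+1}$ via $X$; $T_\zeta M_i$ is perpendicular to $\nu_i(\zeta)$). *)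

theory Defs
  imports "HOL-Analysis.Analysis"
begin

text \<open>Throughout, \<open>\<real>\<^sup>n\<close> is \<open>real ^ 'n\<close> and \<open>\<real>\<^sup>n\<^sup>+\<^sup>1\<close> is \<open>real ^ 'n option\<close>: the index \<open>None\<close> is the first
  coordinate and \<open>Some j\<close> the one after the \<open>j\<close>-th. An identical reordering of rows and columns
  leaves determinants unchanged, so no order on \<open>'n\<close> is needed to speak about orientations.\<close>

subsection \<open>Functions of class \<open>C\<^sup>k\<close>\<close>

text \<open>Used for open \<open>S\<close> only.\<close>

primrec Ck_on :: "nat \<Rightarrow> ('a::euclidean_space \<Rightarrow> 'b::real_normed_vector) \<Rightarrow> 'a set \<Rightarrow> bool" where
  "Ck_on 0 f S \<longleftrightarrow> continuous_on S f"
| "Ck_on (Suc k) f S \<longleftrightarrow>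
     (\<forall>x\<in>S. f differentiable (at x)) \<and>
     (\<forall>v. Ck_on k (\<lambda>x. frechet_derivative f (at x) v) S)"

definition smooth_on :: "('a::euclidean_space \<Rightarrow> 'b::real_normed_vector) \<Rightarrow> 'a set \<Rightarrow> bool" where
  "smooth_on f S \<longleftrightarrow> (\<forall>k. Ck_on k f S)"

text \<open>Class \<open>C\<^sup>k\<close> on an arbitrary subset: locally the restriction of a \<open>C\<^sup>k\<close> function defined on an open
  set. For the unit sphere this is the intrinsic notion.\<close>

definition Ck_on_subset ::
    "nat \<Rightarrow> ('a::euclidean_space \<Rightarrow> 'b::real_normed_vector) \<Rightarrow> 'a set \<Rightarrow> bool" where
  "Ck_on_subset k f S \<longleftrightarrow>
     (\<forall>x\<in>S. \<exists>V g. open V \<and> x \<in> V \<and> Ck_on k g V \<and> (\<forall>y\<in>S \<inter> V. f y = g y))"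

subsection \<open>Anisotropic energy densities\<close>

text \<open>An energy density is a function on the whole space of which only the values on the unit
  sphere matter.\<close>

definition wulff_shape :: "('a::euclidean_space \<Rightarrow> real) \<Rightarrow> 'a set" where
  "wulff_shape \<gamma> = frontier (\<Inter>\<nu>\<in>sphere 0 1. {Y. Y \<bullet> \<nu> \<le> \<gamma> \<nu>})"

definition homogeneous_extension :: "('a::euclidean_space \<Rightarrow> real) \<Rightarrow> 'a \<Rightarrow> real" where
  "homogeneous_extension \<gamma> Y = norm Y * \<gamma> (Y /\<^sub>R norm Y)"

definition convex_integrand :: "('a::euclidean_space \<Rightarrow> real) \<Rightarrow> bool" where
  "convex_integrand \<gamma> \<longleftrightarrow> convex_on UNIV (homogeneous_extension \<gamma>)"

definition convex_integrand_of :: "('a::euclidean_space \<Rightarrow> real) \<Rightarrow> 'a set \<Rightarrow> bool" where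
  "convex_integrand_of \<gamma> W \<longleftrightarrow> wulff_shape \<gamma> = W \<and> convex_integrand \<gamma>"

text \<open>The gradient on the sphere: the tangent vector at \<open>\<nu>\<close> representing the derivative of \<open>\<gamma>\<close>
  along the sphere.\<close>

definition sphere_gradient :: "('a::euclidean_space \<Rightarrow> real) \<Rightarrow> 'a \<Rightarrow> 'a" where
  "sphere_gradient \<gamma> \<nu> =
     (THE D. D \<bullet> \<nu> = 0 \<and> (\<gamma> has_derivative (\<lambda>h. D \<bullet> h)) (at \<nu> within sphere 0 1))"

definition cahn_hoffman :: "('a::euclidean_space \<Rightarrow> real) \<Rightarrow> 'a \<Rightarrow> 'a" where
  "cahn_hoffman \<gamma> \<nu> = sphere_gradient \<gamma> \<nu> + \<gamma> \<nu> *\<^sub>R \<nu>"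

subsection \<open>Oriented smooth manifolds\<close>

text \<open>The manifold is the whole type \<open>'m\<close>. Its smooth structure and orientation are given by an
  atlas, not necessarily maximal, with orientation-preserving smooth transition maps; a chart is a
  pair of its domain and its coordinate map.\<close>

type_synonym ('m, 'n) chart = "'m set \<times> ('m \<Rightarrow> real ^ 'n)"
type_synonym ('m, 'n) atlas = "('m, 'n) chart set"

definition is_chart :: "('m::topological_space, 'n::finite) chart \<Rightarrow> bool" where
  "is_chart c \<longleftrightarrow> (case c of (U, \<phi>) \<Rightarrow>
     open U \<and> open (\<phi> ` U) \<and> homeomorphism U (\<phi> ` U) \<phi> (inv_into U \<phi>))"

text \<open>A map \<open>f\<close> on the manifold, written in the coordinates of a chart, and its differential at \<open>p\<close>
  in these coordinates.\<close>

definition local_rep :: "('m, 'n::finite) chart \<Rightarrow> ('m \<Rightarrow> 'b) \<Rightarrow> real ^ 'n \<Rightarrow> 'b" where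
  "local_rep c f = f \<circ> inv_into (fst c) (snd c)"

definition local_deriv ::
    "('m, 'n::finite) chart \<Rightarrow> ('m \<Rightarrow> 'b::real_normed_vector) \<Rightarrow> 'm \<Rightarrow> real ^ 'n \<Rightarrow> 'b" where
  "local_deriv c f p = frechet_derivative (local_rep c f) (at (snd c p))"

definition oriented_smooth_manifold ::
    "('m::{t2_space, second_countable_topology}, 'n::finite) atlas \<Rightarrow> bool" where
  "oriented_smooth_manifold A \<longleftrightarrow>
     (\<forall>c\<in>A. is_chart c) \<and> (\<Union>c\<in>A. fst c) = UNIV \<and>
     (\<forall>c\<in>A. \<forall>d\<in>A.
        smooth_on (local_rep c (snd d)) (snd c ` (fst c \<inter> fst d)) \<and>
        (\<forall>p\<in>fst c \<inter> fst d. det (matrix (local_deriv c (snd d) p)) > 0))"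

definition Ck_on_manifold ::
    "('m, 'n::finite) atlas \<Rightarrow> nat \<Rightarrow> ('m \<Rightarrow> 'b::real_normed_vector) \<Rightarrow> 'm set \<Rightarrow> bool" where
  "Ck_on_manifold A k f S \<longleftrightarrow>
     (\<forall>c\<in>A. Ck_on_subset k (local_rep c f) (snd c ` (fst c \<inter> S)))"

subsection \<open>Decomposition into submanifolds with piecewise smooth boundary\<close>

text \<open>A topological \<open>n\<close>-manifold with boundary. Since \<open>N\<close> has full dimension, invariance of domain
  shows that, for closed \<open>N\<close>, its manifold interior is \<open>interior N\<close> and its manifold boundary is
  \<open>frontier N\<close>; these are used below.\<close>

definition manifold_with_boundary ::
    "('m::topological_space, 'n::finite) atlas \<Rightarrow> 'm set \<Rightarrow> bool" where
  "manifold_with_boundary (A :: ('m, 'n) atlas) N \<longleftrightarrow>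
     (\<forall>p\<in>N. \<exists>W H a. p \<in> W \<and> openin (top_of_set N) W \<and>
        openin (top_of_set {x :: real ^ 'n. 0 \<le> x $ a}) H \<and> W homeomorphic H)"

text \<open>An embedded \<open>(n-1)\<close>-dimensional smooth submanifold without boundary, not necessarily closed:
  locally a regular level set.\<close>

definition smooth_hypersurface ::
    "('m::topological_space, 'n::finite) atlas \<Rightarrow> 'm set \<Rightarrow> bool" where
  "smooth_hypersurface A H \<longleftrightarrow>
     (\<forall>p\<in>H. \<exists>(U, \<phi>)\<in>A. \<exists>W g. open W \<and> p \<in> W \<and> W \<subseteq> U \<and>
        smooth_on (g :: real ^ 'n \<Rightarrow> real) (\<phi> ` W) \<and>
        (\<forall>x\<in>\<phi> ` W. frechet_derivative g (at x) \<noteq> (\<lambda>_. 0)) \<and>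
        H \<inter> W = {q \<in> W. g (\<phi> q) = 0})"

text \<open>The boundary is a finite union of faces, each of which is a compact region \<open>K\<close> in a smooth
  hypersurface \<open>H\<close>. Faces may meet in corners, edges or cusps of any shape.\<close>

definition piecewise_smooth_boundary ::
    "('m::topological_space, 'n::finite) atlas \<Rightarrow> 'm set \<Rightarrow> bool" where
  "piecewise_smooth_boundary A N \<longleftrightarrow>
     (\<exists>F. finite F \<and> \<Union>F = frontier N \<and>
        (\<forall>K\<in>F. compact K \<and>
           (\<exists>H. smooth_hypersurface A H \<and> K \<subseteq> H \<and> K = closure (top_of_set H interior_of K))))"

definition manifold_decomposition ::
    "('m::topological_space, 'n::finite) atlas \<Rightarrow> nat \<Rightarrow> (nat \<Rightarrow> 'm set) \<Rightarrow> bool" where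
  "manifold_decomposition A k M \<longleftrightarrow>
     (\<Union>i\<in>{1..k}. M i) = UNIV \<and>
     (\<forall>i\<in>{1..k}. M i \<noteq> {} \<and> connected (M i) \<and> compact (M i) \<and>
        manifold_with_boundary A (M i) \<and> piecewise_smooth_boundary A (M i)) \<and>
     (\<forall>i\<in>{1..k}. \<forall>j\<in>{1..k}. i \<noteq> j \<longrightarrow> M i \<inter> M j = frontier (M i) \<inter> frontier (M j))"

subsection \<open>Piecewise \<open>C\<^sup>r\<close> weak immersions\<close>

definition immersion_on ::
    "('m, 'n::finite) atlas \<Rightarrow> nat \<Rightarrow> ('m \<Rightarrow> real ^ 'n option) \<Rightarrow> 'm set \<Rightarrow> bool" where
  "immersion_on A r X S \<longleftrightarrow>
     Ck_on_manifold A r X S \<and> (\<forall>c\<in>A. \<forall>p\<in>fst c \<inter> S. inj (local_deriv c X p))"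

definition singular_set ::
    "('m::topological_space, 'n::finite) atlas \<Rightarrow> nat \<Rightarrow> ('m \<Rightarrow> real ^ 'n option) \<Rightarrow> 'm set" where
  "singular_set A r X = {p. \<not> (\<exists>W. open W \<and> p \<in> W \<and> immersion_on A r X W)}"

text \<open>\<open>v\<close> is the unit normal of \<open>X\<close> at \<open>p\<close> for which \<open>(v, \<partial>\<^sub>1X, \<dots>, \<partial>\<^sub>nX)\<close> is a positively oriented basis.\<close>

definition is_unit_normal ::
    "('m, 'n::finite) atlas \<Rightarrow> ('m \<Rightarrow> real ^ 'n option) \<Rightarrow> 'm \<Rightarrow> real ^ 'n option \<Rightarrow> bool" where
  "is_unit_normal A X p v \<longleftrightarrow> norm v = 1 \<and>
     (\<forall>c\<in>A. p \<in> fst c \<longrightarrow>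
        (\<forall>j. v \<bullet> local_deriv c X p (axis j 1) = 0) \<and>
        det (\<chi> a b. case b of None \<Rightarrow> v $ a | Some j \<Rightarrow> local_deriv c X p (axis j 1) $ a) > 0)"

definition piecewise_weak_immersion ::
    "('m::topological_space, 'n::finite) atlas \<Rightarrow> nat \<Rightarrow> (nat \<Rightarrow> 'm set) \<Rightarrow> nat \<Rightarrow>
      ('m \<Rightarrow> real ^ 'n option) \<Rightarrow> (nat \<Rightarrow> 'm \<Rightarrow> real ^ 'n option) \<Rightarrow> bool" where
  "piecewise_weak_immersion A k M r X \<nu> \<longleftrightarrow>
     continuous_on UNIV X \<and>
     (\<forall>i\<in>{1..k}.
        Ck_on_manifold A r X (M i) \<and>
        immersion_on A r X (interior (M i)) \<and>
        (\<forall>p\<in>interior (M i). is_unit_normal A X p (\<nu> i p)) \<and>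
        \<nu> i ` M i \<subseteq> sphere 0 1 \<and>
        Ck_on_manifold A (r - 1) (\<nu> i) (M i))"

subsection \<open>Constant anisotropic mean curvature\<close>

definition gauss_map ::
    "('m, 'n::finite) atlas \<Rightarrow> ('m \<Rightarrow> real ^ 'n option) \<Rightarrow> 'm \<Rightarrow> real ^ 'n option" where
  "gauss_map A X p = (THE v. is_unit_normal A X p v)"

text \<open>At a regular point \<open>p\<close> both \<open>d(\<xi> \<circ> \<nu>)\<close> and \<open>dX\<close> have values in the orthogonal complement of \<open>\<nu>\<close>,
  which is the range of the injective map \<open>dX\<close>; the endomorphism of the tangent space is
  \<open>dX\<^sup>-\<^sup>1 \<circ> d(\<xi> \<circ> \<nu>)\<close>. Its trace does not depend on the chart \<open>c\<close> around \<open>p\<close>.\<close>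

definition anisotropic_mean_curvature ::
    "('m, 'n::finite) atlas \<Rightarrow> (real ^ 'n option \<Rightarrow> real) \<Rightarrow> ('m \<Rightarrow> real ^ 'n option) \<Rightarrow>
      ('m, 'n) chart \<Rightarrow> 'm \<Rightarrow> real" where
  "anisotropic_mean_curvature A \<gamma> X c p =
     - (1 / real CARD('n)) *
       trace (matrix (inv (local_deriv c X p) \<circ>
         local_deriv c (cahn_hoffman \<gamma> \<circ> gauss_map A X) p))"

text \<open>\<open>T\<^sub>\<zeta>M\<^sub>i\<close>, as a linear subspace of the ambient space, when \<open>v\<close> is the normal \<open>\<nu>\<^sub>i(\<zeta>)\<close>. It is available
  also where the differential of \<open>X\<close> degenerates.\<close>

definition normal_tangent_space :: "'a::real_inner \<Rightarrow> 'a set" where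
  "normal_tangent_space v = {w. w \<bullet> v = 0}"

definition CAMC ::
    "('m::topological_space, 'n::finite) atlas \<Rightarrow> nat \<Rightarrow> (nat \<Rightarrow> 'm set) \<Rightarrow>
      (real ^ 'n option \<Rightarrow> real) \<Rightarrow> ('m \<Rightarrow> real ^ 'n option) \<Rightarrow>
      (nat \<Rightarrow> 'm \<Rightarrow> real ^ 'n option) \<Rightarrow> bool" where
  "CAMC A k M \<gamma> X \<nu> \<longleftrightarrow>
     piecewise_weak_immersion A k M 2 X \<nu> \<and>
     (\<exists>\<Lambda>. \<forall>p\<in>- singular_set A 2 X. \<forall>c\<in>A. p \<in> fst c \<longrightarrow>
        anisotropic_mean_curvature A \<gamma> X c p = \<Lambda>) \<and>
     (\<forall>i\<in>{1..k}. \<forall>j\<in>{1..k}. \<forall>\<zeta>\<in>frontier (M i) \<inter> frontier (M j).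
        cahn_hoffman \<gamma> (\<nu> i \<zeta>) - cahn_hoffman \<gamma> (\<nu> j \<zeta>)
          \<in> normal_tangent_space (\<nu> i \<zeta>) \<inter> normal_tangent_space (\<nu> j \<zeta>))"

end

theory Submission
  imports Defs
begin

text \<open>The Cahn-Hoffman map \<open>\<xi>\<close> is the gradient of the homogeneous extension \<open>F\<close> of \<open>\<gamma>\<close>, and \<open>F\<close> is convex.
  Euler's identity \<open>\<xi>(b) \<bullet> b = F(b)\<close> turns the tangent inequality for \<open>F\<close> at \<open>b\<close> into \<open>\<xi>(b) \<bullet> y \<le> F(y)\<close> for
  all \<open>y\<close>. At a point \<open>\<zeta>\<close> where two pieces of the hypersurface meet, with normals \<open>a\<close> and \<open>b\<close>, the
  CAMC condition says in particular that \<open>\<xi>(a) - \<xi>(b)\<close> is orthogonal to \<open>a\<close>, so \<open>\<xi>(b) \<bullet> a = \<xi>(a) \<bullet> a = F(a)\<close>.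
  Hence the linear function \<open>\<xi>(b)\<close> lies below \<open>F\<close> and touches it at \<open>a\<close>. As \<open>F\<close> is differentiable at \<open>a\<close>, the
  only such linear function is the gradient at \<open>a\<close>, that is, \<open>\<xi>(a) = \<xi>(b)\<close>
  (\<open>cahn_hoffman_eq_if_diff_orthogonal\<close>).

  So the fields \<open>\<xi> \<circ> \<nu>\<^sub>i\<close> agree where the pieces meet. Each is continuous on its piece, since \<open>\<xi>\<close> is
  continuous on the sphere (\<open>continuous_on_cahn_hoffman\<close>), and finitely many continuous maps on closed
  pieces which agree on the overlaps define a continuous map. Convexity is what makes the jump
  condition exclude a jump of \<open>\<xi>\<close>, although the normal itself may jump.\<close>

section \<open>Continuity of maps of class \<open>C\<^sup>k\<close>\<close>

lemma at_within_Int_open: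
  assumes "open V" "x \<in> V"
  shows "at x within S \<inter> V = at x within S"
  using assms by (intro at_within_nhd[of x V]) auto

lemma continuous_on_locally:
  fixes f :: "'a::t2_space \<Rightarrow> 'b::topological_space"
  assumes "\<And>x. x \<in> S \<Longrightarrow> \<exists>V. open V \<and> x \<in> V \<and> continuous_on (S \<inter> V) f"
  shows "continuous_on S f"
  unfolding continuous_on_eq_continuous_within
proof
  fix x assume "x \<in> S"
  with assms obtain V where "open V" "x \<in> V" "continuous_on (S \<inter> V) f" by blast
  with \<open>x \<in> S\<close> show "continuous (at x within S) f"
    using at_within_Int_open by (metis IntI continuous_on_eq_continuous_within)
qed

lemma Ck_on_imp_continuous_on:
  assumes "Ck_on k f S"
  shows "continuous_on S f"
proof (cases k)
  case 0
  then show ?thesis using assms by simp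
next
  case (Suc m)
  then show ?thesis using assms
    by (auto intro!: continuous_at_imp_continuous_on differentiable_imp_continuous_within)
qed

lemma Ck_on_subset_obtain:
  assumes "Ck_on_subset k f S" "x \<in> S"
  obtains V g where "open V" "x \<in> V" "Ck_on k g V" "\<forall>y\<in>S \<inter> V. f y = g y"
  using assms unfolding Ck_on_subset_def by blast

lemma Ck_on_subset_imp_continuous_on:
  assumes "Ck_on_subset k f S"
  shows "continuous_on S f"
proof (rule continuous_on_locally)
  fix x assume x: "x \<in> S"
  obtain V g where V: "open V" "x \<in> V" "Ck_on k g V" "\<forall>y\<in>S \<inter> V. f y = g y"
    by (rule Ck_on_subset_obtain[OF assms x])
  have "continuous_on (S \<inter> V) g"
    using Ck_on_imp_continuous_on[OF V(3)] by (rule continuous_on_subset) simp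
  then have "continuous_on (S \<inter> V) f"
    by (rule continuous_on_eq) (use V(4) in simp)
  with V(1,2) show "\<exists>V. open V \<and> x \<in> V \<and> continuous_on (S \<inter> V) f" by blast
qed

lemma Ck_on_manifold_imp_continuous_on:
  fixes A :: "('m::{t2_space, second_countable_topology}, 'n::finite) atlas"
  assumes A: "oriented_smooth_manifold A" and f: "Ck_on_manifold A k f S"
  shows "continuous_on S f"
proof (rule continuous_on_locally)
  fix p assume p: "p \<in> S"
  obtain U \<phi> where c: "(U, \<phi>) \<in> A" "p \<in> U"
    using A unfolding oriented_smooth_manifold_def by force
  then have U: "open U" and hom: "homeomorphism U (\<phi> ` U) \<phi> (inv_into U \<phi>)"
    using A unfolding oriented_smooth_manifold_def is_chart_def by auto
  have "continuous_on (\<phi> ` (U \<inter> S)) (f \<circ> inv_into U \<phi>)"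
    using f c(1) Ck_on_subset_imp_continuous_on unfolding Ck_on_manifold_def local_rep_def by fastforce
  moreover have "continuous_on (U \<inter> S) \<phi>"
    using hom by (auto simp: homeomorphism_def intro: continuous_on_subset)
  ultimately have "continuous_on (U \<inter> S) (\<lambda>q. (f \<circ> inv_into U \<phi>) (\<phi> q))"
    by (rule continuous_on_compose2) simp
  then have "continuous_on (S \<inter> U) f"
    unfolding Int_commute[of S U]
    by (rule continuous_on_eq) (use hom in \<open>simp add: homeomorphism_def\<close>)
  with U c(2) show "\<exists>V. open V \<and> p \<in> V \<and> continuous_on (S \<inter> V) f" by blast
qed

section \<open>The Cahn-Hoffman map as a gradient\<close>

text \<open>The homogeneous extension is \<open>|Y|\<close> times \<open>\<gamma>\<close> composed with the radial projection onto the sphere, and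
  the derivative of that projection at a unit vector is the orthogonal projection onto the tangent
  space. So the derivative of \<open>\<gamma>\<close> along the sphere determines a derivative in all directions.\<close>

lemma homogeneous_extension_has_derivative:
  fixes \<gamma> :: "'a::euclidean_space \<Rightarrow> real"
  assumes v: "norm v = 1" and D: "D \<bullet> v = 0"
    and der: "(\<gamma> has_derivative (\<lambda>h. D \<bullet> h)) (at v within sphere 0 1)"
  shows "(homogeneous_extension \<gamma> has_derivative (\<lambda>h. (D + \<gamma> v *\<^sub>R v) \<bullet> h)) (at v)"
proof -
  have v0: "v \<noteq> 0" using v by auto
  have at: "at v within - {0} = at v"
    using v0 by (intro at_within_open) auto
  have norm: "(norm has_derivative (\<lambda>h. v \<bullet> h)) (at v)"
    using has_derivative_norm[OF v0] v by (simp add: sgn_div_norm inner_commute)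
  define P :: "'a \<Rightarrow> 'a" where "P = (\<lambda>Y. Y /\<^sub>R norm Y)"
  have Pv: "P v = v" using v by (simp add: P_def)
  have dP: "(P has_derivative (\<lambda>h. h - (v \<bullet> h) *\<^sub>R v)) (at v)"
    unfolding P_def using v0 v
    by (auto intro!: derivative_eq_intros norm simp: algebra_simps)
  have "P Y \<in> sphere 0 1" if "Y \<noteq> 0" for Y
    using that by (simp add: P_def)
  then have "P ` (- {0}) \<subseteq> sphere 0 1" by blast
  then have "(\<gamma> has_derivative (\<lambda>h. D \<bullet> h)) (at (P v) within P ` (- {0}))"
    using der Pv has_derivative_subset by metis
  from has_derivative_in_compose[of P, OF _ this]
  have "((\<lambda>Y. \<gamma> (P Y)) has_derivative (\<lambda>h. D \<bullet> (h - (v \<bullet> h) *\<^sub>R v))) (at v)"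
    using dP by (simp add: at)
  then have comp: "((\<lambda>Y. \<gamma> (P Y)) has_derivative (\<lambda>h. D \<bullet> h)) (at v)"
    using D by (simp add: inner_diff_right)
  have "((\<lambda>Y. norm Y * \<gamma> (P Y)) has_derivative (\<lambda>h. (D + \<gamma> v *\<^sub>R v) \<bullet> h)) (at v)"
    using v Pv has_derivative_mult[OF norm comp]
    by (simp add: inner_add_left add.commute mult.commute)
  then show ?thesis
    unfolding P_def homogeneous_extension_def[abs_def] .
qed

text \<open>The sphere has empty interior, so the uniqueness of derivatives on open sets says nothing about
  derivatives along it. It does apply to the homogeneous extension, whose derivative at \<open>v\<close> determines
  \<open>D\<close>.\<close>

lemma sphere_gradient_eqI:
  fixes \<gamma> :: "'a::euclidean_space \<Rightarrow> real"
  assumes v: "norm v = 1" and D: "D \<bullet> v = 0"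
    and der: "(\<gamma> has_derivative (\<lambda>h. D \<bullet> h)) (at v within sphere 0 1)"
  shows "sphere_gradient \<gamma> v = D"
  unfolding sphere_gradient_def
proof (rule the_equality)
  show "D \<bullet> v = 0 \<and> (\<gamma> has_derivative (\<lambda>h. D \<bullet> h)) (at v within sphere 0 1)"
    using D der by simp
next
  fix E assume E: "E \<bullet> v = 0 \<and> (\<gamma> has_derivative (\<lambda>h. E \<bullet> h)) (at v within sphere 0 1)"
  have "(\<lambda>h. (E + \<gamma> v *\<^sub>R v) \<bullet> h) = (\<lambda>h. (D + \<gamma> v *\<^sub>R v) \<bullet> h)"
    using homogeneous_extension_has_derivative[OF v] E D der
    by (intro has_derivative_unique) auto
  then have "E + \<gamma> v *\<^sub>R v = D + \<gamma> v *\<^sub>R v"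
    by (metis vector_eq_rdot)
  then show "E = D" by simp
qed

text \<open>The tangential part of the gradient \<open>G\<close> of a local extension \<open>g\<close>. Its normal part may be discarded
  because \<open>x \<bullet> x\<close> is constant on the sphere, while its gradient at \<open>v\<close> is \<open>2 v\<close>.\<close>

lemma sphere_has_derivative_tangential:
  fixes \<gamma> g :: "'a::euclidean_space \<Rightarrow> real"
  assumes V: "open V" "v \<in> V" and v: "norm v = 1"
    and eq: "\<forall>y\<in>sphere 0 1 \<inter> V. \<gamma> y = g y"
    and g: "(g has_derivative (\<lambda>h. G \<bullet> h)) (at v)"
  shows "(\<gamma> has_derivative (\<lambda>h. (G - (G \<bullet> v) *\<^sub>R v) \<bullet> h)) (at v within sphere 0 1)"
proof -
  define f where "f = (\<lambda>x. g x - (G \<bullet> v) * ((x \<bullet> x - 1) / 2))"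
  have "(f has_derivative (\<lambda>h. (G - (G \<bullet> v) *\<^sub>R v) \<bullet> h)) (at v)"
    unfolding f_def
    by (auto intro!: derivative_eq_intros g simp: algebra_simps inner_commute)
  then have f: "(f has_derivative (\<lambda>h. (G - (G \<bullet> v) *\<^sub>R v) \<bullet> h)) (at v within sphere 0 1 \<inter> V)"
    by (rule has_derivative_at_withinI)
  have "f y = \<gamma> y" if "y \<in> sphere 0 1 \<inter> V" for y
    using that eq by (simp add: f_def dot_square_norm)
  then have "(\<gamma> has_derivative (\<lambda>h. (G - (G \<bullet> v) *\<^sub>R v) \<bullet> h)) (at v within sphere 0 1 \<inter> V)"
    using f V v by (intro has_derivative_transform[OF _ _ f]) auto
  then show ?thesis
    using V by (simp add: at_within_Int_open)
qed

definition gradient :: "('a::euclidean_space \<Rightarrow> real) \<Rightarrow> 'a \<Rightarrow> 'a" where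
  "gradient g x = (\<Sum>e\<in>Basis. frechet_derivative g (at x) e *\<^sub>R e)"

lemma has_derivative_gradient:
  fixes g :: "'a::euclidean_space \<Rightarrow> real"
  assumes "g differentiable (at x)"
  shows "(g has_derivative (\<lambda>h. gradient g x \<bullet> h)) (at x)"
proof -
  have d: "(g has_derivative frechet_derivative g (at x)) (at x)"
    using assms by (simp add: frechet_derivative_works)
  then interpret linear "frechet_derivative g (at x)"
    by (rule has_derivative_linear)
  have "frechet_derivative g (at x) = (\<lambda>h. gradient g x \<bullet> h)"
  proof
    fix h
    have "frechet_derivative g (at x) h = frechet_derivative g (at x) (\<Sum>e\<in>Basis. (h \<bullet> e) *\<^sub>R e)"
      by (simp add: euclidean_representation)
    also have "\<dots> = gradient g x \<bullet> h"
      by (simp add: gradient_def sum scale inner_sum_left inner_commute[of h] mult.commute)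
    finally show "frechet_derivative g (at x) h = gradient g x \<bullet> h" .
  qed
  then show ?thesis using d by simp
qed

lemma Ck_on_Suc_continuous_on_gradient:
  assumes "Ck_on (Suc k) g V"
  shows "continuous_on V (gradient g)"
proof -
  have "continuous_on V (\<lambda>x. frechet_derivative g (at x) e)" for e
    using assms by (intro Ck_on_imp_continuous_on[of k]) simp
  then show ?thesis
    unfolding gradient_def[abs_def] by (intro continuous_intros)
qed

text \<open>An extension \<open>g\<close> of \<open>\<gamma>\<close> to an open set \<open>V\<close> serves all unit vectors in \<open>V\<close> at once. This formula therefore
  shows that the gradient on the sphere exists, and also that \<open>\<xi>\<close> is as regular near \<open>v\<close> as the gradient
  of \<open>g\<close>.\<close>

lemma cahn_hoffman_local_formula:
  fixes \<gamma> :: "'a::euclidean_space \<Rightarrow> real"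
  assumes V: "open V" "v \<in> V" and v: "norm v = 1"
    and eq: "\<forall>y\<in>sphere 0 1 \<inter> V. \<gamma> y = g y"
    and g: "g differentiable (at v)"
  defines "D \<equiv> gradient g v - (gradient g v \<bullet> v) *\<^sub>R v"
  shows "D \<bullet> v = 0"
    and "(\<gamma> has_derivative (\<lambda>h. D \<bullet> h)) (at v within sphere 0 1)"
    and "cahn_hoffman \<gamma> v = D + \<gamma> v *\<^sub>R v"
proof -
  show D: "D \<bullet> v = 0"
    using v by (simp add: D_def inner_diff_left dot_square_norm)
  show der: "(\<gamma> has_derivative (\<lambda>h. D \<bullet> h)) (at v within sphere 0 1)"
    unfolding D_def
    using sphere_has_derivative_tangential[OF V v eq has_derivative_gradient[OF g]] .
  show "cahn_hoffman \<gamma> v = D + \<gamma> v *\<^sub>R v"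
    using sphere_gradient_eqI[OF v D der] by (simp add: cahn_hoffman_def)
qed

lemma cahn_hoffman_is_gradient:
  fixes \<gamma> :: "'a::euclidean_space \<Rightarrow> real"
  assumes \<gamma>: "Ck_on_subset (Suc k) \<gamma> (sphere 0 1)" and v: "norm v = 1"
  shows cahn_hoffman_inner_self: "cahn_hoffman \<gamma> v \<bullet> v = \<gamma> v"
    and homogeneous_extension_has_derivative_cahn_hoffman:
      "(homogeneous_extension \<gamma> has_derivative (\<lambda>h. cahn_hoffman \<gamma> v \<bullet> h)) (at v)"
proof -
  have v1: "v \<in> sphere 0 1" using v by simp
  obtain V g where V: "open V" "v \<in> V" "Ck_on (Suc k) g V" "\<forall>y\<in>sphere 0 1 \<inter> V. \<gamma> y = g y"
    by (rule Ck_on_subset_obtain[OF \<gamma> v1])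
  have g: "g differentiable (at v)" using V(2,3) by simp
  note formula = cahn_hoffman_local_formula[OF V(1,2) v V(4) g]
  show "cahn_hoffman \<gamma> v \<bullet> v = \<gamma> v"
    using formula(1,3) v by (simp add: inner_add_left dot_square_norm)
  show "(homogeneous_extension \<gamma> has_derivative (\<lambda>h. cahn_hoffman \<gamma> v \<bullet> h)) (at v)"
    using homogeneous_extension_has_derivative[OF v formula(1,2)] formula(3) by simp
qed

lemma continuous_on_cahn_hoffman:
  fixes \<gamma> :: "'a::euclidean_space \<Rightarrow> real"
  assumes \<gamma>: "Ck_on_subset (Suc k) \<gamma> (sphere 0 1)"
  shows "continuous_on (sphere 0 1) (cahn_hoffman \<gamma>)"
proof (rule continuous_on_locally)
  fix v :: 'a assume v: "v \<in> sphere 0 1"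
  obtain V g where V: "open V" "v \<in> V" "Ck_on (Suc k) g V" "\<forall>y\<in>sphere 0 1 \<inter> V. \<gamma> y = g y"
    by (rule Ck_on_subset_obtain[OF \<gamma> v])
  have grad: "continuous_on (sphere 0 1 \<inter> V) (gradient g)"
    using Ck_on_Suc_continuous_on_gradient[OF V(3)] continuous_on_subset by blast
  have cont: "continuous_on (sphere 0 1 \<inter> V) \<gamma>"
    using Ck_on_subset_imp_continuous_on[OF \<gamma>] continuous_on_subset by blast
  have "continuous_on (sphere 0 1 \<inter> V)
      (\<lambda>y. gradient g y - (gradient g y \<bullet> y) *\<^sub>R y + \<gamma> y *\<^sub>R y)"
    by (intro continuous_intros grad cont)
  moreover have "cahn_hoffman \<gamma> y = gradient g y - (gradient g y \<bullet> y) *\<^sub>R y + \<gamma> y *\<^sub>R y"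
    if "y \<in> sphere 0 1 \<inter> V" for y
    using cahn_hoffman_local_formula(3)[OF V(1) _ _ V(4), of y] V(3) that by auto
  ultimately have "continuous_on (sphere 0 1 \<inter> V) (cahn_hoffman \<gamma>)"
    by (rule continuous_on_eq[OF _ sym])
  with V(1,2) show "\<exists>V. open V \<and> v \<in> V \<and> continuous_on (sphere 0 1 \<inter> V) (cahn_hoffman \<gamma>)"
    by blast
qed

section \<open>The Cahn-Hoffman vectors at a jump of the normal\<close>

text \<open>Restricting \<open>F\<close> to the line through \<open>b\<close> and \<open>y\<close> reduces this to one variable.\<close>

lemma convex_on_above_tangent_plane:
  fixes F :: "'a::real_inner \<Rightarrow> real"
  assumes F: "convex_on UNIV F" and der: "(F has_derivative (\<lambda>h. G \<bullet> h)) (at b)"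
  shows "F y - F b \<ge> G \<bullet> (y - b)"
proof -
  define \<phi> where "\<phi> = (\<lambda>t::real. F (b + t *\<^sub>R (y - b)))"
  have "convex_on UNIV \<phi>"
  proof (rule convex_onI)
    fix t x z :: real assume t: "0 < t" "t < 1"
    have "b + ((1 - t) *\<^sub>R x + t *\<^sub>R z) *\<^sub>R (y - b)
        = (1 - t) *\<^sub>R (b + x *\<^sub>R (y - b)) + t *\<^sub>R (b + z *\<^sub>R (y - b))"
      by (simp add: algebra_simps)
    then show "\<phi> ((1 - t) *\<^sub>R x + t *\<^sub>R z) \<le> (1 - t) * \<phi> x + t * \<phi> z"
      unfolding \<phi>_def using convex_onD[OF F, of t] t by simp
  qed simp
  moreover have "(\<phi> has_real_derivative G \<bullet> (y - b)) (at 0)"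
  proof -
    have "((\<lambda>t::real. b + t *\<^sub>R (y - b)) has_derivative (\<lambda>t. t *\<^sub>R (y - b))) (at 0)"
      by (auto intro!: derivative_eq_intros)
    from has_derivative_compose[OF this, of F "\<lambda>h. G \<bullet> h"] der
    show ?thesis by (simp add: \<phi>_def has_field_derivative_def mult_commute_abs)
  qed
  ultimately have "\<phi> 1 - \<phi> 0 \<ge> (G \<bullet> (y - b)) * (1 - 0)"
    by (intro convex_on_imp_above_tangent[where A = UNIV]) auto
  then show ?thesis by (simp add: \<phi>_def)
qed

text \<open>Geometrically, \<open>\<xi>(b)\<close> is a point of the Wulff shape, and the hypothesis puts it on the supporting
  hyperplane with normal \<open>a\<close>. Differentiability of the support function \<open>F\<close> at \<open>a\<close> means that
  this hyperplane meets the Wulff shape in the single point \<open>\<xi>(a)\<close>.\<close>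

lemma cahn_hoffman_eq_if_diff_orthogonal:
  fixes \<gamma> :: "'a::euclidean_space \<Rightarrow> real"
  assumes \<gamma>: "Ck_on_subset (Suc k) \<gamma> (sphere 0 1)" and conv: "convex_integrand \<gamma>"
    and a: "norm a = 1" and b: "norm b = 1"
    and orth: "(cahn_hoffman \<gamma> a - cahn_hoffman \<gamma> b) \<bullet> a = 0"
  shows "cahn_hoffman \<gamma> a = cahn_hoffman \<gamma> b"
proof -
  let ?F = "homogeneous_extension \<gamma>" and ?\<xi> = "cahn_hoffman \<gamma>"
  have F_unit: "?F v = \<gamma> v" if "norm v = 1" for v
    using that by (simp add: homogeneous_extension_def)
  have below: "?\<xi> b \<bullet> y \<le> ?F y" for y
    using convex_on_above_tangent_plane[OF conv[unfolded convex_integrand_def]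
        homogeneous_extension_has_derivative_cahn_hoffman[OF \<gamma> b], of y]
      cahn_hoffman_inner_self[OF \<gamma> b] F_unit[OF b]
    by (simp add: inner_diff_right)
  have touch: "?\<xi> b \<bullet> a = ?F a"
    using orth cahn_hoffman_inner_self[OF \<gamma> a] F_unit[OF a] by (simp add: inner_diff_left)
  \<comment> \<open>The difference is nonnegative and vanishes at \<open>a\<close>, so its derivative at this minimum is zero.\<close>
  have "((\<lambda>y. ?F y - ?\<xi> b \<bullet> y) has_derivative (\<lambda>h. ?\<xi> a \<bullet> h - ?\<xi> b \<bullet> h)) (at a)"
    by (intro derivative_intros homogeneous_extension_has_derivative_cahn_hoffman[OF \<gamma> a])
  then have "(\<lambda>h. ?\<xi> a \<bullet> h - ?\<xi> b \<bullet> h) = (\<lambda>h. 0)"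
    by (rule has_derivative_local_min) (simp add: touch below)
  then show ?thesis
    by (metis (no_types) eq_iff_diff_eq_0 vector_eq_rdot)
qed

section \<open>Pasting the Cahn-Hoffman fields\<close>

lemma pasting_finite_closed_cover:
  fixes f :: "'i \<Rightarrow> 'a::topological_space \<Rightarrow> 'b::topological_space"
  assumes fin: "finite I" and cover: "(\<Union>i\<in>I. M i) = UNIV"
    and closed: "\<And>i. i \<in> I \<Longrightarrow> closed (M i)"
    and cont: "\<And>i. i \<in> I \<Longrightarrow> continuous_on (M i) (f i)"
    and agree: "\<And>i j p. \<lbrakk>i \<in> I; j \<in> I; p \<in> M i; p \<in> M j\<rbrakk> \<Longrightarrow> f i p = f j p"
  shows "\<exists>g. continuous_on UNIV g \<and> (\<forall>i\<in>I. \<forall>p\<in>M i. g p = f i p)"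
proof -
  obtain s where s: "\<And>p. s p \<in> I \<and> p \<in> M (s p)"
    using cover by (metis UNIV_I UN_E)
  define g where "g p = f (s p) p" for p
  have g: "g p = f i p" if "i \<in> I" "p \<in> M i" for i p
    unfolding g_def using agree s that by blast
  have "continuous_on (M i) g" if "i \<in> I" for i
    using cont[OF that] by (rule continuous_on_eq) (simp add: g[OF that])
  then have "continuous_on (\<Union>i\<in>I. M i) g"
    using fin closed by (intro continuous_on_closed_Union) auto
  then show ?thesis using g cover by auto
qed

theorem theorem9p1:
  fixes \<gamma> :: "real ^ ('n::finite) option \<Rightarrow> real"
    and A :: "('m::{t2_space, second_countable_topology}, 'n) atlas"
    and k :: nat
    and M :: "nat \<Rightarrow> 'm set"
    and X :: "'m \<Rightarrow> real ^ 'n option"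
    and \<nu> :: "nat \<Rightarrow> 'm \<Rightarrow> real ^ 'n option"
  assumes "\<forall>v\<in>sphere 0 1. \<gamma> v > 0"
    and "Ck_on_subset 2 \<gamma> (sphere 0 1)"
    and "convex_integrand_of \<gamma> (wulff_shape \<gamma>)"
    and "oriented_smooth_manifold A"
    and "compact (UNIV :: 'm set)"
    and "connected (UNIV :: 'm set)"
    and "manifold_decomposition A k M"
    and "CAMC A k M \<gamma> X \<nu>"
  shows "\<exists>\<xi>t :: 'm \<Rightarrow> real ^ 'n option. continuous_on UNIV \<xi>t \<and>
           (\<forall>i\<in>{1..k}. \<forall>p\<in>M i. \<xi>t p = cahn_hoffman \<gamma> (\<nu> i p))"
proof -
  have \<gamma>: "Ck_on_subset (Suc 1) \<gamma> (sphere 0 1)"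
    using assms(2) by (simp add: numeral_2_eq_2)
  have conv: "convex_integrand \<gamma>"
    using assms(3) by (simp add: convex_integrand_of_def)
  have cover: "(\<Union>i\<in>{1..k}. M i) = UNIV"
    and M: "\<And>i. i \<in> {1..k} \<Longrightarrow> compact (M i)"
    and overlap: "\<And>i j. \<lbrakk>i \<in> {1..k}; j \<in> {1..k}; i \<noteq> j\<rbrakk> \<Longrightarrow> M i \<inter> M j = frontier (M i) \<inter> frontier (M j)"
    using assms(7) unfolding manifold_decomposition_def by blast+
  have sphere: "\<And>i. i \<in> {1..k} \<Longrightarrow> \<nu> i ` M i \<subseteq> sphere 0 1"
    and \<nu>: "\<And>i. i \<in> {1..k} \<Longrightarrow> Ck_on_manifold A (2 - 1) (\<nu> i) (M i)"
    and jump: "\<And>i j \<zeta>. \<lbrakk>i \<in> {1..k}; j \<in> {1..k}; \<zeta> \<in> frontier (M i) \<inter> frontier (M j)\<rbrakk> \<Longrightarrow>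
      cahn_hoffman \<gamma> (\<nu> i \<zeta>) - cahn_hoffman \<gamma> (\<nu> j \<zeta>) \<in> normal_tangent_space (\<nu> i \<zeta>)"
    using assms(8) unfolding CAMC_def piecewise_weak_immersion_def by blast+
  show ?thesis
  proof (rule pasting_finite_closed_cover)
    show "continuous_on (M i) (\<lambda>p. cahn_hoffman \<gamma> (\<nu> i p))" if i: "i \<in> {1..k}" for i
      using continuous_on_compose2[OF continuous_on_cahn_hoffman[OF \<gamma>]
          Ck_on_manifold_imp_continuous_on[OF assms(4) \<nu>[OF i]] sphere[OF i]] .
  next
    fix i j p assume ij: "i \<in> {1..k}" "j \<in> {1..k}" and p: "p \<in> M i" "p \<in> M j"
    show "cahn_hoffman \<gamma> (\<nu> i p) = cahn_hoffman \<gamma> (\<nu> j p)"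
    proof (cases "i = j")
      case False
      then have "p \<in> frontier (M i) \<inter> frontier (M j)"
        using overlap[OF ij] p by blast
      from jump[OF ij this]
      have "(cahn_hoffman \<gamma> (\<nu> i p) - cahn_hoffman \<gamma> (\<nu> j p)) \<bullet> \<nu> i p = 0"
        by (simp add: normal_tangent_space_def)
      moreover have "norm (\<nu> i p) = 1" "norm (\<nu> j p) = 1"
        using sphere[OF ij(1)] sphere[OF ij(2)] p by auto
      ultimately show ?thesis
        using cahn_hoffman_eq_if_diff_orthogonal[OF \<gamma> conv] by blast
    qed simp
  qed (use cover M in \<open>auto intro: compact_imp_closed\<close>)
qed

end
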